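(* For every integer $\ell\ge 1$, setting $n=2^{2\ell-1}+1$, one has $$R(B_{n-2},B_n)=4n-3.$$
   Context: For a positive integer $n$, the book graph $B_n=K_2+\overline{K}_n$ is the graph consisting of $n$ triangles sharing a common edge. The Ramsey number $R(B_m,B_n)$ is the smallest integer $N$ such that every red/blue coloring of the edges of $K_N$ contains a red copy of $B_m$ or a blue copy of $B_n$ (copies are as not necessarily induced subgraphs). *)

theory Defs
  imports "HOL-Library.Ramsey"
begin

text \<open>
  A finite simple graph: \<open>edges\<close> consists of two-element subsets of \<open>verts\<close>.
  All graphs built below have this property.
\<close>

datatype 'a graph = Graph (verts: "'a set") (edges: "'a set set")

definition complete_graph :: "nat \<Rightarrow> nat graph" where
  "complete_graph n = Graph {..<n} (nsets {..<n} 2)"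

definition graph_complement :: "'a graph \<Rightarrow> 'a graph" where
  "graph_complement G = Graph (verts G) (nsets (verts G) 2 - edges G)"

definition graph_join :: "'a graph \<Rightarrow> 'b graph \<Rightarrow> ('a + 'b) graph" where
  "graph_join G H =
     Graph (verts G <+> verts H)
       ((`) Inl ` edges G \<union> (`) Inr ` edges H \<union>
        {{Inl x, Inr y} | x y. x \<in> verts G \<and> y \<in> verts H})"

definition book_graph :: "nat \<Rightarrow> (nat + nat) graph" where
  "book_graph n = graph_join (complete_graph 2) (graph_complement (complete_graph n))"

text \<open>Copies are not necessarily induced: only edges have to be preserved.\<close>

definition contains_copy :: "'a graph \<Rightarrow> 'b graph \<Rightarrow> bool" where
  "contains_copy G H \<longleftrightarrow>
     (\<exists>f. inj_on f (verts H) \<and> f ` verts H \<subseteq> verts G \<and> (\<forall>e \<in> edges H. f ` e \<in> edges G))"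

datatype colour = Red | Blue

definition colour_class :: "'a graph \<Rightarrow> ('a set \<Rightarrow> colour) \<Rightarrow> colour \<Rightarrow> 'a graph" where
  "colour_class G c k = Graph (verts G) {e \<in> edges G. c e = k}"

text \<open>
  A colouring is a total function on sets of vertices; only its values on the edges of the
  complete graph matter.
\<close>

definition ramsey_number :: "'a graph \<Rightarrow> 'b graph \<Rightarrow> nat" where
  "ramsey_number H1 H2 =
     (LEAST N. \<forall>c. contains_copy (colour_class (complete_graph N) c Red) H1 \<or>
                   contains_copy (colour_class (complete_graph N) c Blue) H2)"

end

theory Submission imports Defs "HOL-Number_Theory.Cong"
begin

text \<open>
  Put \<open>m = n - 1\<close>. For the lower bound, let \<open>H\<close> be a symmetric Hadamard matrix of order \<open>2m = 4^l\<close>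
  with constant diagonal 1, a tensor power of one of order 4, and colour the pairs \<open>(x, t)\<close>,
  \<open>t = 1\<close> or \<open>t = -1\<close>, by making \<open>(x, t)(y, t')\<close> red iff \<open>H x y = t t'\<close>. For the upper bound, Goodman's
  count of monochromatic triangles in a book-free colouring on \<open>4m + 1\<close> vertices is forced to be
  tight, so the red graph is strongly regular with parameters \<open>(4m + 1, 2m, m - 2, m + 1)\<close>. The
  number of its closed walks of length 5 is divisible by 5, as rotation acts on them without
  fixed points, but as \<open>m\<close> is an odd power of 2 the spectrum shows that it is not.
\<close>

section \<open>Books as edges with many common neighbours\<close>

text \<open>A copy is given by the images of the spine \<open>{Inl 0, Inl 1}\<close> and of the
  pages \<open>Inr j\<close>. As copies need not be induced, the pages can be any \<open>n\<close>
  distinct common neighbours in colour \<open>k\<close>, so both bounds become statements about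
  numbers of common neighbours.\<close>

lemma contains_copy_book_graph_iff:
  "contains_copy (colour_class (complete_graph N) c k) (book_graph n) \<longleftrightarrow>
     (\<exists>x<N. \<exists>y<N. x \<noteq> y \<and> c {x, y} = k \<and>
        n \<le> card {z. z < N \<and> z \<noteq> x \<and> z \<noteq> y \<and> c {x, z} = k \<and> c {y, z} = k})"
  (is "?L \<longleftrightarrow> ?R")
proof -
  have two: "nsets {..<2::nat} 2 = {{0, 1}}"
    by (auto simp: nsets_2_eq lessThan_nat_numeral lessThan_Suc insert_commute)
  have verts: "verts (book_graph n) = Inl ` {..<2} \<union> Inr ` {..<n}"
    by (auto simp: book_graph_def graph_join_def complete_graph_def graph_complement_def)
  have edges: "edges (book_graph n) =
      insert {Inl 0, Inl 1} {{Inl i, Inr j} | i j. i < 2 \<and> j < n}"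
    by (auto simp: book_graph_def graph_join_def complete_graph_def graph_complement_def two)
  have colour_edge: "{x, y} \<in> edges (colour_class (complete_graph N) c k) \<longleftrightarrow>
      x < N \<and> y < N \<and> x \<noteq> y \<and> c {x, y} = k" for x y
    by (auto simp: colour_class_def complete_graph_def nsets_2_eq doubleton_eq_iff)
  have vertsN: "verts (colour_class (complete_graph N) c k) = {..<N}"
    by (simp add: colour_class_def complete_graph_def)
  show ?thesis
  proof
    assume ?L
    then obtain f where inj: "inj_on f (verts (book_graph n))"
      and e: "\<And>e. e \<in> edges (book_graph n) \<Longrightarrow> f ` e \<in> edges (colour_class (complete_graph N) c k)"
      unfolding contains_copy_def by blast
    define x y where "x = f (Inl 0)" and "y = f (Inl 1)"
    have xy: "x < N" "y < N" "x \<noteq> y" "c {x, y} = k"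
      using e[of "{Inl 0, Inl 1}"] by (simp_all add: edges colour_edge x_def y_def)
    have page: "f (Inr j) < N" "x \<noteq> f (Inr j)" "c {x, f (Inr j)} = k"
        "y \<noteq> f (Inr j)" "c {y, f (Inr j)} = k" if "j < n" for j
    proof -
      have "{Inl 0, Inr j} \<in> edges (book_graph n)" "{Inl 1, Inr j} \<in> edges (book_graph n)"
        unfolding edges using that by fastforce+
      from this[THEN e] show "f (Inr j) < N" "x \<noteq> f (Inr j)" "c {x, f (Inr j)} = k"
        "y \<noteq> f (Inr j)" "c {y, f (Inr j)} = k"
        by (simp_all add: colour_edge x_def y_def)
    qed
    have "inj_on (f \<circ> Inr) {..<n}"
      using inj unfolding verts by (auto simp: inj_on_def)
    from card_image[OF this] have "n = card ((f \<circ> Inr) ` {..<n})"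
      by simp
    also have "\<dots> \<le> card {z. z < N \<and> z \<noteq> x \<and> z \<noteq> y \<and> c {x, z} = k \<and> c {y, z} = k}"
      by (rule card_mono) (use page in force)+
    finally show ?R
      using xy by blast
  next
    assume ?R
    then obtain x y where xy: "x < N" "y < N" "x \<noteq> y" "c {x, y} = k"
      and n: "n \<le> card {z. z < N \<and> z \<noteq> x \<and> z \<noteq> y \<and> c {x, z} = k \<and> c {y, z} = k}" (is "_ \<le> card ?Z")
      by blast
    obtain h where h: "inj_on h {..<n}" "h ` {..<n} \<subseteq> ?Z"
      using card_le_inj[of "{..<n}" ?Z] n by auto
    define f where "f = case_sum (\<lambda>i::nat. if i = 0 then x else y) h"
    have hZ: "h j < N \<and> h j \<noteq> x \<and> h j \<noteq> y \<and> c {x, h j} = k \<and> c {y, h j} = k" if "j < n" for j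
      using h(2) that by blast
    have "inj_on f (Inl ` {..<2})"
      using xy(3) by (auto simp: inj_on_def f_def less_2_cases_iff)
    moreover have "inj_on f (Inr ` {..<n})"
      using h(1) by (auto simp: inj_on_def f_def)
    moreover have "f (Inl i) \<noteq> f (Inr j)" if "j < n" for i j
      using hZ[OF that] by (auto simp: f_def)
    then have "f ` Inl ` {..<2} \<inter> f ` Inr ` {..<n} = {}"
      by auto
    ultimately have "inj_on f (verts (book_graph n))"
      unfolding verts inj_on_Un by blast
    moreover have "f ` verts (book_graph n) \<subseteq> {..<N}"
      using hZ xy by (auto simp: verts f_def)
    moreover have "f ` e \<in> edges (colour_class (complete_graph N) c k)"
      if e: "e \<in> edges (book_graph n)" for e
    proof -
      consider "e = {Inl 0, Inl 1}" | i j where "e = {Inl i, Inr j}" "i < 2" "j < n"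
        using e unfolding edges by blast
      then show ?thesis
      proof cases
        case 1
        then have "f ` e = {x, y}" by (simp add: f_def)
        with xy show ?thesis by (simp add: colour_edge)
      next
        case 2
        then have "f ` e = {x, h j} \<or> f ` e = {y, h j}" by (simp add: f_def)
        then show ?thesis
          using xy hZ[OF 2(3)] by (elim disjE) (simp_all add: colour_edge)
      qed
    qed
    ultimately show ?L
      unfolding contains_copy_def vertsN by blast
  qed
qed

section \<open>Symmetric Hadamard matrices and the lower bound\<close>

text \<open>Signs, symmetry and diagonal are required at all indices, so that ranges have to be
  checked only where orthogonality is used.\<close>

definition symmetric_hadamard :: "nat \<Rightarrow> (nat \<Rightarrow> nat \<Rightarrow> int) \<Rightarrow> bool" where
  "symmetric_hadamard N H \<longleftrightarrow>
     (\<forall>i j. H i j = 1 \<or> H i j = -1) \<and> (\<forall>i j. H i j = H j i) \<and> (\<forall>i. H i i = 1) \<and>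
     (\<forall>i<N. \<forall>j<N. i \<noteq> j \<longrightarrow> (\<Sum>k<N. H i k * H j k) = 0)"

lemma symmetric_hadamardD:
  assumes "symmetric_hadamard N H"
  shows "H i j = 1 \<or> H i j = -1" "H i j = H j i" "H i i = 1"
    "i < N \<Longrightarrow> j < N \<Longrightarrow> i \<noteq> j \<Longrightarrow> (\<Sum>k<N. H i k * H j k) = 0"
  using assms unfolding symmetric_hadamard_def by blast+

text \<open>Induction by Kronecker product with \<open>K\<close>, the matrix of order 4 with -1 on
  the antidiagonal and 1 elsewhere. Two of its rows disagree in exactly two columns, and an
  antidiagonal of even order misses the diagonal, which therefore stays 1.\<close>

lemma ex_symmetric_hadamard_power_4: "\<exists>H. symmetric_hadamard (4 ^ l) H"
proof (induction l)
  case 0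
  show ?case by (rule exI[of _ "\<lambda>_ _. 1"]) (simp add: symmetric_hadamard_def)
next
  case (Suc l)
  then obtain H where "symmetric_hadamard (4 ^ l) H"
    by blast
  note H = symmetric_hadamardD[OF this]
  define K :: "nat \<Rightarrow> nat \<Rightarrow> int" where "K i j = (if i + j = 3 then -1 else 1)" for i j
  define H' where "H' i j = H (i div 4) (j div 4) * K (i mod 4) (j mod 4)" for i j
  have K: "(\<Sum>r<4. K i r * K j r) = (if i = j then 4 else 0)" if "i < 4" "j < 4" for i j
  proof -
    have 4: "{..<4::nat} = {0, 1, 2, 3}" by auto
    have "i \<in> {0, 1, 2, 3}" "j \<in> {0, 1, 2, 3}" using that by auto
    then show ?thesis
      unfolding 4 by (elim insertE emptyE) (simp_all add: K_def)
  qed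
  have "(\<Sum>k<4 ^ Suc l. H' i k * H' j k) = 0" if "i < 4 ^ Suc l" "j < 4 ^ Suc l" "i \<noteq> j" for i j
  proof -
    \<comment> \<open>Columns are written as \<open>q*4+r\<close>, so that the inner product of two
      rows factors into one for \<open>H\<close> and one for \<open>K\<close>.\<close>
    have "(\<Sum>k<4 ^ Suc l. H' i k * H' j k) = (\<Sum>q<4 ^ l. \<Sum>k=q*4..<q*4+4. H' i k * H' j k)"
      using sum.nat_group[of "\<lambda>k. H' i k * H' j k" 4 "4 ^ l"] by (simp add: mult.commute)
    also have "\<dots> = (\<Sum>q<4 ^ l. \<Sum>r<4. H' i (q*4+r) * H' j (q*4+r))"
      by (rule sum.cong[OF refl]) (simp add: sum.atLeastLessThan_shift_0[of _ "_ * 4"] atLeast0LessThan)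
    also have "\<dots> = (\<Sum>q<4 ^ l. H (i div 4) q * H (j div 4) q *
        (\<Sum>r<4. K (i mod 4) r * K (j mod 4) r))"
      by (simp add: H'_def sum_distrib_left mult_ac)
    also have "\<dots> = (\<Sum>q<4 ^ l. H (i div 4) q * H (j div 4) q) *
        (\<Sum>r<4. K (i mod 4) r * K (j mod 4) r)"
      by (simp add: sum_distrib_right)
    also have "\<dots> = 0"
    \<comment> \<open>Distinct rows with equal residues have distinct quotients, so the factor from
      \<open>H\<close> vanishes; otherwise the factor from \<open>K\<close> does.\<close>
    proof (cases "i mod 4 = j mod 4")
      case True
      then have "i div 4 \<noteq> j div 4"
        using \<open>i \<noteq> j\<close> by (metis div_mult_mod_eq)
      with H(4)[of "i div 4" "j div 4"] that show ?thesis
        by (simp add: less_mult_imp_div_less mult.commute)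
    qed (simp add: K)
    finally show ?thesis .
  qed
  moreover have "H' i j = 1 \<or> H' i j = -1" for i j
    using H(1)[of "i div 4" "j div 4"] by (auto simp: H'_def K_def)
  moreover have "H' i j = H' j i" for i j
    using H(2)[of "i div 4" "j div 4"] by (simp add: H'_def K_def add.commute)
  moreover have "H' i i = 1" for i
  proof -
    have "i mod 4 + i mod 4 \<noteq> 3" by presburger
    then show ?thesis by (simp add: H'_def K_def H(3))
  qed
  ultimately show ?case
    unfolding symmetric_hadamard_def by blast
qed

text \<open>The term \<open>1 + s * h z\<close> is 2 where \<open>h z = s\<close> and 0
  elsewhere.\<close>

lemma card_sign_of_sum_eq_0:
  fixes h :: "nat \<Rightarrow> int"
  assumes "\<And>z. h z = 1 \<or> h z = -1" "s = 1 \<or> s = -1" "(\<Sum>z<M. h z) = 0"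
  shows "2 * card {z. z < M \<and> h z = s} = M"
proof -
  have "(\<Sum>z<M. 1 + s * h z) = (\<Sum>z<M. 2 * of_bool (h z = s))"
  proof (rule sum.cong[OF refl])
    fix z show "1 + s * h z = 2 * of_bool (h z = s)"
      using assms(1)[of z] assms(2) by auto
  qed
  also have "\<dots> = 2 * int (card {z. z < M \<and> h z = s})"
    by (simp add: sum_distrib_left[symmetric] sum.If_cases of_bool_def Int_def)
  finally have "int M = 2 * int (card {z. z < M \<and> h z = s})"
    by (simp add: sum.distrib sum_distrib_left[symmetric] assms(3))
  then show ?thesis by linarith
qed

text \<open>Covering every \<open>N\<close> up to \<open>4 * m\<close> yields the minimality of the
  Ramsey number directly. Loops are red because the diagonal is 1, so the ends of a red edge are
  among their own common red neighbours, which lowers the bound \<open>m\<close> to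
  \<open>m - 2\<close> for red pages.\<close>

lemma ex_colouring_without_books:
  assumes "2 * m = 4 ^ l" "N \<le> 4 * m" "m \<ge> 2"
  shows "\<exists>c. \<not> contains_copy (colour_class (complete_graph N) c Red) (book_graph (m - 1)) \<and>
             \<not> contains_copy (colour_class (complete_graph N) c Blue) (book_graph (m + 1))"
proof -
  obtain H where "symmetric_hadamard (2 * m) H"
    using ex_symmetric_hadamard_power_4[of l] assms(1) by auto
  note H = symmetric_hadamardD[OF this]
  \<comment> \<open>Vertex \<open>u\<close> encodes the row \<open>u div 2\<close> together with the
    sign \<open>(-1) ^ u\<close>.\<close>
  define red where "red u v \<longleftrightarrow> H (u div 2) (v div 2) = (-1) ^ (u + v)" for u v :: nat
  define c where "c e = (if \<exists>u v. e = {u, v} \<and> red u v then Red else Blue)" for e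
  have red_sym: "red u v \<longleftrightarrow> red v u" for u v
    by (simp add: red_def H(2)[of "u div 2"] add.commute)
  have red_refl: "red u u" for u
    by (simp add: red_def H(3))
  have c: "c {u, v} = Red \<longleftrightarrow> red u v" "c {u, v} = Blue \<longleftrightarrow> \<not> red u v" for u v
    using red_sym by (auto simp: c_def doubleton_eq_iff)
  \<comment> \<open>Two rows of a Hadamard matrix agree in exactly half of the columns, so every pair of
    vertices has at most \<open>m\<close> common neighbours of either colour, counting loops as red.\<close>
  have common: "card {w. w < N \<and> red u w = b \<and> red v w = b} \<le> m"
    if uv: "u < N" "v < N" "u \<noteq> v" for u v b
  proof -
    define W where "W = {w. w < N \<and> red u w = b \<and> red v w = b}"
    define h where "h z = H (u div 2) z * H (v div 2) z" for z
    define Z where "Z = {z. z < 2 * m \<and> h z = (-1) ^ (u + v)}"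
    have sgn: "(-1::int) ^ k = 1 \<or> (-1::int) ^ k = -1" for k
      by (cases "even k") auto
    have h_sgn: "h z = 1 \<or> h z = -1" for z
      using H(1)[of "u div 2" z] H(1)[of "v div 2" z] by (auto simp: h_def)
    have Hb: "H (x div 2) (w div 2) = (if b then 1 else -1) * (-1) ^ (x + w)"
      if "red x w = b" for x w
      using that H(1)[of "x div 2" "w div 2"] sgn[of "x + w"] by (auto simp: red_def)
    \<comment> \<open>Once its colour to \<open>u\<close> is fixed, the row of \<open>w\<close>
      determines the sign of \<open>w\<close>, hence \<open>w\<close> itself.\<close>
    have "inj_on (\<lambda>w. w div 2) W"
    proof (rule inj_onI)
      fix w w' assume w: "w \<in> W" "w' \<in> W" "w div 2 = w' div 2"
      then have "(-1::int) ^ (u + w) = (-1) ^ (u + w')"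
        using Hb[of u w] Hb[of u w'] by (auto simp: W_def)
      then have "even w \<longleftrightarrow> even w'"
        by (cases "even u"; cases "even w"; cases "even w'") auto
      with w(3) show "w = w'"
        by presburger
    qed
    moreover have "(\<lambda>w. w div 2) ` W \<subseteq> Z"
    proof safe
      fix w assume w: "w \<in> W"
      \<comment> \<open>In the product both the sign of \<open>w\<close> and the sign coming from
        \<open>b\<close> cancel.\<close>
      have "h (w div 2) = (-1) ^ (u + w) * (-1) ^ (v + w)"
        using Hb[of u w] Hb[of v w] w by (auto simp: W_def h_def)
      also have "\<dots> = (-1) ^ (u + v)"
        by (simp add: power_add)
      finally show "w div 2 \<in> Z"
        using w assms(2) by (auto simp: Z_def W_def)
    qed
    ultimately have "card W \<le> card Z"
      by (intro card_inj_on_le[of "\<lambda>w. w div 2"]) (auto simp: Z_def)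
    also have "card Z \<le> m"
    proof (cases "u div 2 = v div 2")
      \<comment> \<open>Two vertices with the same row have opposite signs, so \<open>Z\<close> is
        empty.\<close>
      case True
      with uv(3) have "odd (u + v)" by presburger
      moreover have "h z = 1" for z
        using H(1)[of "v div 2" z] True by (auto simp: h_def)
      ultimately show ?thesis by (simp add: Z_def)
    next
      case False
      then have "(\<Sum>z<2 * m. h z) = 0"
        unfolding h_def using uv assms(2) by (intro H(4)) auto
      from card_sign_of_sum_eq_0[OF h_sgn sgn this] show ?thesis
        by (simp add: Z_def)
    qed
    finally show ?thesis by (simp add: W_def)
  qed
  have "\<not> contains_copy (colour_class (complete_graph N) c Red) (book_graph (m - 1))"
  proof
    assume "contains_copy (colour_class (complete_graph N) c Red) (book_graph (m - 1))"
    then obtain u v where uv: "u < N" "v < N" "u \<noteq> v" "red u v"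
      and m: "m - 1 \<le> card {w. w < N \<and> w \<noteq> u \<and> w \<noteq> v \<and> red u w \<and> red v w}" (is "_ \<le> card ?W")
      unfolding contains_copy_book_graph_iff c by blast
    have "card (insert u (insert v ?W)) = card ?W + 2"
      using uv by simp
    moreover have "insert u (insert v ?W) = {w. w < N \<and> red u w = True \<and> red v w = True}"
      using uv red_refl red_sym by auto
    ultimately have "card ?W + 2 \<le> m"
      using common[of u v True] uv by simp
    with m assms(3) show False by linarith
  qed
  moreover have "\<not> contains_copy (colour_class (complete_graph N) c Blue) (book_graph (m + 1))"
  proof
    assume "contains_copy (colour_class (complete_graph N) c Blue) (book_graph (m + 1))"
    then obtain u v where uv: "u < N" "v < N" "u \<noteq> v"
      and m: "m + 1 \<le> card {w. w < N \<and> w \<noteq> u \<and> w \<noteq> v \<and> \<not> red u w \<and> \<not> red v w}" (is "_ \<le> card ?W")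
      unfolding contains_copy_book_graph_iff c by blast
    have "card ?W \<le> card {w. w < N \<and> red u w = False \<and> red v w = False}"
      by (rule card_mono) auto
    with m common[of u v False] uv show False by simp
  qed
  ultimately show ?thesis by blast
qed

section \<open>Closed walks of length 5 and the spectrum modulo 5\<close>

text \<open>The iterates of \<open>f\<close> act on \<open>S\<close> as a cyclic group of prime
  order, so every orbit that is not a fixed point has exactly \<open>p\<close> elements, and the
  orbits partition \<open>S\<close>.\<close>

lemma prime_dvd_card_if_no_fixpoint:
  assumes "prime p" "finite S" "f ` S \<subseteq> S"
    and period: "\<And>x. x \<in> S \<Longrightarrow> (f ^^ p) x = x"
    and no_fix: "\<And>x. x \<in> S \<Longrightarrow> f x \<noteq> x"
  shows "p dvd card S"
proof -
  have p: "p > 0" using \<open>prime p\<close> prime_gt_0_nat by blast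
  have in_S: "(f ^^ i) x \<in> S" if "x \<in> S" for i x
    using that assms(3) by (induction i) auto
  have mod_p: "(f ^^ i) x = (f ^^ (i mod p)) x" if "x \<in> S" for i x
    using funpow_mod_eq[of p f x i] period[OF that] by simp
  define orb where "orb x = (\<lambda>i. (f ^^ i) x) ` {..<p}" for x
  have orb_UNIV: "orb x = range (\<lambda>i. (f ^^ i) x)" if "x \<in> S" for x
    unfolding orb_def using p mod_p[OF that] by (auto simp: image_iff intro!: bexI[of _ "_ mod p"])
  have orb_eq: "orb y = orb x" if x: "x \<in> S" and y: "y \<in> orb x" for x y
  proof -
    obtain i where i: "i < p" "y = (f ^^ i) x" using y by (auto simp: orb_def)
    then have "y \<in> S" using in_S x by blast
    have "(f ^^ j) y \<in> orb x" for j
      unfolding orb_UNIV[OF x] using i by (auto simp: funpow_add intro!: image_eqI[of _ _ "j + i"])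
    \<comment> \<open>After \<open>p - i\<close> further steps \<open>y\<close> returns to
      \<open>x\<close>.\<close>
    moreover have "(f ^^ j) x = (f ^^ (j + (p - i))) y" for j
    proof -
      have "(f ^^ (j + (p - i))) y = (f ^^ (j + (p - i) + i)) x"
        by (simp only: i(2) funpow_add o_apply)
      also have "j + (p - i) + i = j + p" using i by simp
      also have "(f ^^ (j + p)) x = (f ^^ j) x"
        using period[OF x] by (simp add: funpow_add)
      finally show ?thesis by simp
    qed
    ultimately show ?thesis
      unfolding orb_UNIV[OF x] orb_UNIV[OF \<open>y \<in> S\<close>] by blast
  qed
  have card_orb: "card (orb x) = p" if x: "x \<in> S" for x
  proof -
    have "inj_on (\<lambda>i. (f ^^ i) x) {..<p}"
    proof (rule linorder_inj_onI')
      fix i j assume ij: "i \<in> {..<p}" "j \<in> {..<p}" "i < j"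
      show "(f ^^ i) x \<noteq> (f ^^ j) x"
      proof
        assume eq: "(f ^^ i) x = (f ^^ j) x"
        define d where "d = j - i"
        have "(f ^^ d) x = (f ^^ (p - i + j)) x"
        proof -
          have "p - i + j = d + p" using ij by (simp add: d_def)
          then show ?thesis using period[OF x] by (simp add: funpow_add)
        qed
        also have "\<dots> = (f ^^ (p - i + i)) x"
          by (simp only: funpow_add o_apply eq)
        also have "\<dots> = x"
          using ij period[OF x] by simp
        finally have d: "(f ^^ d) x = x" .
        have "coprime d p"
        proof -
          have "\<not> p dvd d" using ij by (auto simp: d_def dest: dvd_imp_le)
          then show ?thesis
            using prime_imp_coprime[OF \<open>prime p\<close>] coprime_commute by blast
        qed
        \<comment> \<open>By Bezout some multiple of \<open>d\<close> is 1 modulo \<open>p\<close>,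
          so if \<open>f ^^ d\<close> fixes \<open>x\<close> then so does \<open>f\<close>.\<close>
        have "d > 0" using ij by (simp add: d_def)
        then obtain a b where ab: "d * a = p * b + 1"
          using \<open>coprime d p\<close> bezout_nat[of d p] by auto
        have "f x = (f ^^ ((p * b + 1) mod p)) x"
          using prime_gt_1_nat[OF \<open>prime p\<close>] by (simp only: mod_mult_self4) simp
        also have "\<dots> = (f ^^ (d * a)) x"
          using mod_p[OF x, of "p * b + 1"] ab by simp
        also have "\<dots> = x"
          using d funpow_mod_eq[of d f x "d * a"] by simp
        finally show False using no_fix[OF x] by blast
      qed
    qed
    then show ?thesis by (simp add: orb_def card_image)
  qed
  have S: "\<Union> (orb ` S) = S"
  proof safe
    fix x assume "x \<in> S"
    then show "x \<in> \<Union> (orb ` S)" using p by (force simp: orb_def)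
  qed (auto simp: orb_def in_S)
  have "p dvd card (\<Union> (orb ` S))"
  proof (rule dvd_partition)
    show "finite (\<Union> (orb ` S))" using \<open>finite S\<close> S by simp
    show "\<forall>c\<in>orb ` S. p dvd card c" using card_orb by auto
    show "\<forall>c1\<in>orb ` S. \<forall>c2\<in>orb ` S. c1 \<noteq> c2 \<longrightarrow> c1 \<inter> c2 = {}"
      using orb_eq by blast
  qed
  then show ?thesis by (simp add: S)
qed


text \<open>The sum is the trace of the fifth power of the adjacency matrix and counts closed walks
  with a base point. A walk fixed by rotation would be constant and so need a loop.\<close>

lemma five_dvd_closed_walks_5:
  fixes R :: "'a \<Rightarrow> 'a \<Rightarrow> bool"
  assumes "finite V" and irrefl: "\<And>x. \<not> R x x"
  defines "A \<equiv> \<lambda>x y. of_bool (R x y) :: int"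
  shows "5 dvd (\<Sum>a\<in>V. \<Sum>b\<in>V. \<Sum>c\<in>V. \<Sum>d\<in>V. \<Sum>e\<in>V. A a b * A b c * A c d * A d e * A e a)"
proof -
  define S where "S = {(a, b, c, d, e). a \<in> V \<and> b \<in> V \<and> c \<in> V \<and> d \<in> V \<and> e \<in> V \<and>
    R a b \<and> R b c \<and> R c d \<and> R d e \<and> R e a}"
  define rot where "rot = (\<lambda>(a, b, c, d, e). (b, c, d, e, a) :: 'a \<times> 'a \<times> 'a \<times> 'a \<times> 'a)"
  have sub: "S \<subseteq> V \<times> V \<times> V \<times> V \<times> V"
    by (auto simp: S_def)
  have fin: "finite (V \<times> V \<times> V \<times> V \<times> V)"
    using \<open>finite V\<close> by simp
  have "5 dvd card S"
  proof (rule prime_dvd_card_if_no_fixpoint)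
    show "finite S" using sub fin by (rule finite_subset)
    show "rot ` S \<subseteq> S" by (auto simp: S_def rot_def)
    show "(rot ^^ 5) x = x" if "x \<in> S" for x
      by (cases x) (simp add: rot_def eval_nat_numeral)
    show "rot x \<noteq> x" if "x \<in> S" for x
      using that irrefl by (auto simp: S_def rot_def)
  qed simp
  moreover have "int (card S) = (\<Sum>x\<in>V \<times> V \<times> V \<times> V \<times> V. of_bool (x \<in> S))"
    using fin sub by (simp add: of_bool_def sum.If_cases Int_absorb1)
  moreover have "\<dots> = (\<Sum>a\<in>V. \<Sum>b\<in>V. \<Sum>c\<in>V. \<Sum>d\<in>V. \<Sum>e\<in>V. A a b * A b c * A c d * A d e * A e a)"
    unfolding sum.cartesian_product
    by (intro sum.cong refl) (auto simp: S_def A_def)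
  ultimately show ?thesis
    by (metis of_nat_dvd_iff of_nat_numeral)
qed

lemma sum_mult_of_bool_eq:
  fixes f :: "'a \<Rightarrow> 'b::semiring_1"
  assumes "finite V" "x \<in> V"
  shows "(\<Sum>z\<in>V. f z * of_bool (x = z)) = f x" "(\<Sum>z\<in>V. f z * of_bool (z = x)) = f x"
  using assms by (simp_all add: of_bool_def if_distrib sum.delta sum.delta' cong: if_cong)

text \<open>
  The adjacency matrix satisfies \<open>A\<^sup>2 = -3A + (m - 1)I + (m + 1)J\<close>, so on the complement of the
  all-ones vector \<open>(2A + 3)\<^sup>2 = 4m + 5\<close>. When this is a non-residue modulo 5, Frobenius swaps the
  two eigenvalues, which makes the trace of \<open>A\<^sup>5\<close> nonzero modulo 5.
\<close>

lemma no_srg_mod_5: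
  fixes R :: "'a \<Rightarrow> 'a \<Rightarrow> bool" and m :: int
  assumes "finite V" "int (card V) = 4 * m + 1"
    and sym: "\<And>x y. R x y \<longleftrightarrow> R y x" and irrefl: "\<And>x. \<not> R x x"
  defines "A \<equiv> \<lambda>x y. of_bool (R x y) :: int"
  assumes deg: "\<And>x. x \<in> V \<Longrightarrow> (\<Sum>y\<in>V. A x y) = 2 * m"
    and sq: "\<And>x y. x \<in> V \<Longrightarrow> y \<in> V \<Longrightarrow>
        (\<Sum>z\<in>V. A x z * A z y) = -3 * A x y + (m - 1) * of_bool (x = y) + (m + 1)"
  shows "m mod 5 \<noteq> 2 \<and> m mod 5 \<noteq> 3"
proof -
  define P where "P x y = -3 * A x y + (m - 1) * of_bool (x = y) + (m + 1)" for x y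
  have A_sym: "A x y = A y x" for x y using sym by (simp add: A_def)
  have deg': "(\<Sum>y\<in>V. A y x) = 2 * m" if "x \<in> V" for x
    using deg[OF that] by (simp add: A_sym[of _ x])
  note delta = sum_mult_of_bool_eq[OF \<open>finite V\<close>]
  \<comment> \<open>The coefficient of \<open>J\<close> in the fourth power of \<open>A\<close>,
    from \<open>AJ = JA = 2mJ\<close> and \<open>JJ = (4m + 1)J\<close>.\<close>
  define C where "C = 9 * (m + 1) + 2 * (m - 1) * (m + 1) - 12 * m * (m + 1) + (m + 1)^2 * (4 * m + 1)"
  have PP: "(\<Sum>z\<in>V. P x z * P z y) = (- 27 - 6 * (m - 1)) * A x y +
      (9 * (m - 1) + (m - 1)^2) * of_bool (x = y) + C"
    if xy: "x \<in> V" "y \<in> V" for x y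
  proof -
    have "(\<Sum>z\<in>V. P x z * P z y) =
      (\<Sum>z\<in>V. 9 * (A x z * A z y) - 3 * (m - 1) * (A x z * of_bool (z = y)) - 3 * (m + 1) * A x z
        - 3 * (m - 1) * (A z y * of_bool (x = z))
        + (m - 1)^2 * (of_bool (x = z) * of_bool (z = y)) + (m - 1) * (m + 1) * (1 * of_bool (x = z))
        - 3 * (m + 1) * A z y + (m - 1) * (m + 1) * (1 * of_bool (z = y)) + (m + 1)^2)"
      by (intro sum.cong refl) (simp add: P_def algebra_simps power2_eq_square)
    also have "\<dots> = 9 * (\<Sum>z\<in>V. A x z * A z y) - 3 * (m - 1) * (\<Sum>z\<in>V. A x z * of_bool (z = y))
        - 3 * (m + 1) * (\<Sum>z\<in>V. A x z)
        - 3 * (m - 1) * (\<Sum>z\<in>V. A z y * of_bool (x = z))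
        + (m - 1)^2 * (\<Sum>z\<in>V. of_bool (x = z) * of_bool (z = y))
        + (m - 1) * (m + 1) * (\<Sum>z\<in>V. 1 * of_bool (x = z))
        - 3 * (m + 1) * (\<Sum>z\<in>V. A z y) + (m - 1) * (m + 1) * (\<Sum>z\<in>V. 1 * of_bool (z = y))
        + (m + 1)^2 * int (card V)"
      unfolding sum.distrib sum_subtractf sum_distrib_left[symmetric] by (simp add: mult_ac)
    also have "\<dots> = 9 * P x y - 3 * (m - 1) * A x y - 3 * (m + 1) * (2 * m) - 3 * (m - 1) * A x y
        + (m - 1)^2 * of_bool (x = y) + (m - 1) * (m + 1) * 1
        - 3 * (m + 1) * (2 * m) + (m - 1) * (m + 1) * 1 + (m + 1)^2 * (4 * m + 1)"
      unfolding delta[OF xy(1)] delta[OF xy(2)] deg[OF xy(1)] deg'[OF xy(2)] sq[OF xy] assms(2) P_def ..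
    also have "\<dots> = (- 27 - 6 * (m - 1)) * A x y + (9 * (m - 1) + (m - 1)^2) * of_bool (x = y) + C"
      by (simp add: P_def C_def algebra_simps power2_eq_square)
    finally show ?thesis .
  qed
  \<comment> \<open>Summing over \<open>b\<close> and \<open>d\<close> innermost splits off two
    entries of the square of \<open>A\<close>.\<close>
  have "(\<Sum>a\<in>V. \<Sum>b\<in>V. \<Sum>c\<in>V. \<Sum>d\<in>V. \<Sum>e\<in>V. A a b * A b c * A c d * A d e * A e a) =
      (\<Sum>a\<in>V. \<Sum>c\<in>V. \<Sum>e\<in>V. \<Sum>b\<in>V. \<Sum>d\<in>V. A a b * A b c * A c d * A d e * A e a)"
  proof (rule sum.cong[OF refl])
    fix a
    have "(\<Sum>b\<in>V. \<Sum>c\<in>V. \<Sum>d\<in>V. \<Sum>e\<in>V. A a b * A b c * A c d * A d e * A e a) =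
        (\<Sum>c\<in>V. \<Sum>b\<in>V. \<Sum>e\<in>V. \<Sum>d\<in>V. A a b * A b c * A c d * A d e * A e a)"
      by (subst sum.swap) (intro sum.cong refl sum.swap)
    also have "\<dots> = (\<Sum>c\<in>V. \<Sum>e\<in>V. \<Sum>b\<in>V. \<Sum>d\<in>V. A a b * A b c * A c d * A d e * A e a)"
      by (intro sum.cong refl sum.swap)
    finally show "(\<Sum>b\<in>V. \<Sum>c\<in>V. \<Sum>d\<in>V. \<Sum>e\<in>V. A a b * A b c * A c d * A d e * A e a) = \<dots>" .
  qed
  also have "\<dots> = (\<Sum>a\<in>V. \<Sum>c\<in>V. \<Sum>e\<in>V. (\<Sum>b\<in>V. A a b * A b c) * (\<Sum>d\<in>V. A c d * A d e) * A e a)"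
    unfolding sum_product unfolding sum_distrib_right by (simp only: mult.assoc)
  also have "\<dots> = (\<Sum>a\<in>V. \<Sum>c\<in>V. \<Sum>e\<in>V. P a c * P c e * A e a)"
    by (simp add: sq P_def)
  also have "\<dots> = (\<Sum>a\<in>V. \<Sum>e\<in>V. \<Sum>c\<in>V. P a c * P c e * A e a)"
    by (intro sum.cong refl sum.swap)
  also have "\<dots> = (\<Sum>a\<in>V. \<Sum>e\<in>V. ((- 27 - 6 * (m - 1)) + C) * A e a)"
  proof (rule sum.cong[OF refl], rule sum.cong[OF refl])
    fix a e assume "a \<in> V" "e \<in> V"
    have "(\<Sum>c\<in>V. P a c * P c e * A e a) = (\<Sum>c\<in>V. P a c * P c e) * A e a"
      by (simp add: sum_distrib_right)
    \<comment> \<open>With the weight \<open>A e a\<close> only adjacent pairs count, so the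
      identity term of \<open>PP\<close> drops out.\<close>
    also have "\<dots> = ((- 27 - 6 * (m - 1)) + C) * A e a"
      unfolding PP[OF \<open>a \<in> V\<close> \<open>e \<in> V\<close>] by (cases "a = e") (auto simp: A_def irrefl sym[of a e])
    finally show "(\<Sum>c\<in>V. P a c * P c e * A e a) = \<dots>" .
  qed
  also have "\<dots> = ((- 27 - 6 * (m - 1)) + C) * ((4 * m + 1) * (2 * m))"
    by (simp add: sum_distrib_left[symmetric] deg' assms(2))
  also have "\<dots> = (4 * m^3 - m^2 - 3 * m - 13) * ((4 * m + 1) * (2 * m))"
    by (simp add: C_def algebra_simps power2_eq_square power3_eq_cube)
  finally have dvd: "5 dvd (4 * m^3 - m^2 - 3 * m - 13) * ((4 * m + 1) * (2 * m))"
    using five_dvd_closed_walks_5[of V R] assms(1) irrefl unfolding A_def by metis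
  have False if r: "m mod 5 = r" "r = 2 \<or> r = 3" for r
  proof -
    have "[m = r] (mod 5)" using r by (auto simp: cong_def)
    then have "[(4 * m^3 - m^2 - 3 * m - 13) * ((4 * m + 1) * (2 * m)) =
        (4 * r^3 - r^2 - 3 * r - 13) * ((4 * r + 1) * (2 * r))] (mod 5)"
      by (intro cong_mult cong_diff cong_add cong_pow cong_refl)
    then have "5 dvd (4 * r^3 - r^2 - 3 * r - 13) * ((4 * r + 1) * (2 * r))"
      using dvd cong_dvd_iff by blast
    \<comment> \<open>The product is 324 for \<open>r = 2\<close> and 6006 for
      \<open>r = 3\<close>.\<close>
    then show False using r(2) by auto
  qed
  then show ?thesis by blast
qed

section \<open>Goodman's count and strong regularity\<close>

text \<open>
  The slack \<open>s\<close> of the two hypotheses, summed over all pairs of vertices, equals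
  \<open>-(\<Sum>x\<in>V. e x * (3 * e x + 2))\<close> with \<open>e x = d x - 2m\<close>, and \<open>e (3 e + 2)\<close> is nonnegative
  on the integers, with a zero only at 0.
\<close>

lemma book_free_imp_srg:
  fixes R :: "'a \<Rightarrow> 'a \<Rightarrow> bool" and m :: int
  assumes "finite V" "int (card V) = 4 * m + 1"
    and sym: "\<And>x y. R x y \<longleftrightarrow> R y x" and irrefl: "\<And>x. \<not> R x x"
  defines "A \<equiv> \<lambda>x y. of_bool (R x y) :: int"
  defines "B \<equiv> \<lambda>x y. of_bool (x \<noteq> y \<and> \<not> R x y) :: int"
  assumes red: "\<And>x y. x \<in> V \<Longrightarrow> y \<in> V \<Longrightarrow> R x y \<Longrightarrow> (\<Sum>z\<in>V. A x z * A z y) \<le> m - 2"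
    and blue: "\<And>x y. x \<in> V \<Longrightarrow> y \<in> V \<Longrightarrow> x \<noteq> y \<Longrightarrow> \<not> R x y \<Longrightarrow> (\<Sum>z\<in>V. B x z * B z y) \<le> m"
  shows "\<And>x. x \<in> V \<Longrightarrow> (\<Sum>y\<in>V. A x y) = 2 * m"
    and "\<And>x y. x \<in> V \<Longrightarrow> y \<in> V \<Longrightarrow>
        (\<Sum>z\<in>V. A x z * A z y) = -3 * A x y + (m - 1) * of_bool (x = y) + (m + 1)"
proof -
  define d where "d x = (\<Sum>y\<in>V. A x y)" for x
  define P where "P x y = (\<Sum>z\<in>V. A x z * A z y)" for x y
  have A_sym: "A x y = A y x" for x y using sym by (simp add: A_def)
  have d': "(\<Sum>y\<in>V. A y x) = d x" for x by (simp add: d_def A_sym[of _ x])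
  have Pxx: "P x x = d x" for x
    unfolding P_def d_def by (intro sum.cong refl) (simp add: A_def sym)
  note delta = sum_mult_of_bool_eq[OF \<open>finite V\<close>]
  have B_eq: "B x y = 1 - of_bool (x = y) - A x y" for x y
    by (auto simp: A_def B_def irrefl)
  \<comment> \<open>Inclusion-exclusion over the \<open>4 * m - 1\<close> vertices other than
    \<open>x\<close> and \<open>y\<close>.\<close>
  have blue_common: "(\<Sum>z\<in>V. B x z * B z y) = 4 * m - 1 - d x - d y + P x y"
    if xy: "x \<in> V" "y \<in> V" "x \<noteq> y" "\<not> R x y" for x y
  proof -
    have "(\<Sum>z\<in>V. B x z * B z y) = (\<Sum>z\<in>V. 1 - 1 * of_bool (x = z) - 1 * of_bool (z = y) - A x z - A z y
        + A x z * of_bool (z = y) + A z y * of_bool (x = z) + A x z * A z y)"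
      using xy by (intro sum.cong refl) (auto simp: B_eq algebra_simps)
    also have "\<dots> = 4 * m - 1 - d x - d y + P x y"
      unfolding sum.distrib sum_subtractf delta[OF xy(1)] delta[OF xy(2)] P_def[symmetric] d' d_def[symmetric]
      using xy by (simp add: assms(2) A_def)
    finally show ?thesis .
  qed
  define s where "s x y = A x y * (m - 2 - P x y) + B x y * (m - (4 * m - 1 - d x - d y + P x y))" for x y
  have s_nonneg: "s x y \<ge> 0" if "x \<in> V" "y \<in> V" for x y
  proof (cases "x \<noteq> y \<and> \<not> R x y")
    case True
    then show ?thesis
      using blue[of x y] blue_common[of x y] that by (simp add: s_def A_def B_def)
  next
    case False
    then show ?thesis
      using red[of x y] that irrefl by (auto simp: s_def A_def B_def P_def)
  qed
  \<comment> \<open>Eliminating \<open>B\<close> cancels the products of \<open>A x y\<close> with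
    \<open>P x y\<close>: the red triangle count disappears, and only degrees survive summation. The
    last term makes the diagonal vanish.\<close>
  have s_eq: "s x y = (4 * m - 3) * A x y - A x y * d x - A x y * d y - 3 * m + 1 + d x + d y - P x y
      + (3 * m - 1 - d x) * of_bool (x = y)" for x y
    using irrefl by (auto simp: s_def A_def B_def Pxx)
  have sum_s_row: "(\<Sum>y\<in>V. s x y) = (4 * m - 3) * d x - d x * d x - (\<Sum>y\<in>V. A x y * d y)
     - (3 * m - 1) * (4 * m + 1) + (4 * m + 1) * d x + (\<Sum>y\<in>V. d y) - (\<Sum>y\<in>V. P x y)
     + (3 * m - 1 - d x)" if "x \<in> V" for x
    unfolding s_eq sum.distrib sum_subtractf delta(1)[OF that, of "\<lambda>_. 3 * m - 1 - d x"]
    unfolding sum_distrib_left[symmetric] sum_distrib_right[symmetric] d_def[symmetric]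
    by (simp add: assms(2)) (simp add: algebra_simps)
  \<comment> \<open>Together with \<open>Ad\<close>, this turns the double sums of
    \<open>P x y\<close> and of \<open>A x y * d y\<close> into the sum of the squared
    degrees.\<close>
  have P_row: "(\<Sum>y\<in>V. P x y) = (\<Sum>z\<in>V. A x z * d z)" for x
    unfolding P_def by (subst sum.swap) (simp add: sum_distrib_left[symmetric] d_def)
  have Ad: "(\<Sum>x\<in>V. \<Sum>y\<in>V. A x y * d y) = (\<Sum>x\<in>V. d x * d x)"
    by (subst sum.swap) (simp add: sum_distrib_right[symmetric] d')
  define g where "g x = (d x - 2 * m) * (3 * (d x - 2 * m) + 2)" for x
  have "(\<Sum>x\<in>V. \<Sum>y\<in>V. s x y) + (\<Sum>x\<in>V. g x) = 0"
  proof -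
    define D D2 where "D = (\<Sum>x\<in>V. d x)" and "D2 = (\<Sum>x\<in>V. d x * d x)"
    have "(\<Sum>x\<in>V. \<Sum>y\<in>V. s x y) = (\<Sum>x\<in>V. (4 * m - 3) * d x - d x * d x - (\<Sum>y\<in>V. A x y * d y)
     - (3 * m - 1) * (4 * m + 1) + (4 * m + 1) * d x + D - (\<Sum>y\<in>V. A x y * d y)
     + (3 * m - 1 - d x))"
      by (intro sum.cong refl) (simp add: sum_s_row P_row D_def)
    also have "\<dots> = (4 * m - 3) * D - D2 - D2 - (4 * m + 1) * ((3 * m - 1) * (4 * m + 1))
        + (4 * m + 1) * D + (4 * m + 1) * D - D2 + (4 * m + 1) * (3 * m - 1) - D"
      unfolding sum.distrib sum_subtractf Ad D2_def[symmetric] sum_distrib_left[symmetric] D_def[symmetric]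
      by (simp add: assms(2) algebra_simps)
    finally have 1: "(\<Sum>x\<in>V. \<Sum>y\<in>V. s x y) = \<dots>" .
    have "(\<Sum>x\<in>V. g x) = (\<Sum>x\<in>V. 3 * (d x * d x) - (12 * m - 2) * d x + (12 * m * m - 4 * m))"
      by (intro sum.cong refl) (simp add: g_def algebra_simps)
    also have "\<dots> = 3 * D2 - (12 * m - 2) * D + (4 * m + 1) * (12 * m * m - 4 * m)"
      unfolding sum.distrib sum_subtractf D2_def sum_distrib_left[symmetric] D_def
      by (simp add: assms(2) algebra_simps)
    finally show ?thesis
      unfolding 1 by (simp add: algebra_simps)
  qed
  moreover have g_nonneg: "g x \<ge> 0" for x
    unfolding g_def by (cases "d x - 2 * m \<ge> 0") (auto intro: mult_nonneg_nonneg mult_nonpos_nonpos)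
  moreover have s_row_nonneg: "(\<Sum>y\<in>V. s x y) \<ge> 0" if "x \<in> V" for x
    using s_nonneg that by (auto intro: sum_nonneg)
  ultimately have sum0: "(\<Sum>x\<in>V. \<Sum>y\<in>V. s x y) = 0" "(\<Sum>x\<in>V. g x) = 0"
    using sum_nonneg[of V g] sum_nonneg[of V "\<lambda>x. \<Sum>y\<in>V. s x y"] by force+
  have d: "d x = 2 * m" if "x \<in> V" for x
  proof -
    have "g x = 0"
      using sum0(2) g_nonneg \<open>finite V\<close> that by (simp add: sum_nonneg_eq_0_iff)
    then have "d x - 2 * m = 0 \<or> 3 * (d x - 2 * m) + 2 = 0"
      unfolding g_def mult_eq_0_iff .
    then show ?thesis by presburger
  qed
  have s0: "s x y = 0" if "x \<in> V" "y \<in> V" for x y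
  proof -
    have "(\<Sum>y\<in>V. s x y) = 0"
      using sum0(1) s_row_nonneg \<open>finite V\<close> that by (simp add: sum_nonneg_eq_0_iff)
    then show ?thesis
      using s_nonneg \<open>finite V\<close> that by (simp add: sum_nonneg_eq_0_iff)
  qed
  show "(\<Sum>y\<in>V. A x y) = 2 * m" if "x \<in> V" for x
    using d[OF that] by (simp add: d_def)
  \<comment> \<open>Zero slack gives \<open>m - 2\<close> on red pairs and \<open>m + 1\<close> on
    blue ones; the diagonal entry is the degree, \<open>2 * m = (m - 1) + (m + 1)\<close>.\<close>
  show "(\<Sum>z\<in>V. A x z * A z y) = -3 * A x y + (m - 1) * of_bool (x = y) + (m + 1)"
    if "x \<in> V" "y \<in> V" for x y
    using s0[OF that] d[OF that(1)] d[OF that(2)] Pxx[of x] irrefl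
    unfolding P_def[symmetric] by (cases "x = y"; cases "R x y") (auto simp: s_def A_def B_def)
qed

section \<open>The upper bound and the value of the Ramsey number\<close>

text \<open>Multiplication by 4, which is -1 modulo 5, swaps 2 and 3, the residues excluded by
  \<open>no_srg_mod_5\<close>.\<close>

lemma mod_5_two_power_odd:
  "int (2 ^ (2 * k + 1)) mod 5 = 2 \<or> int (2 ^ (2 * k + 1)) mod 5 = 3"
proof (induction k)
  case (Suc k)
  have "int (2 ^ (2 * Suc k + 1)) = 4 * int (2 ^ (2 * k + 1))" by simp
  moreover have "4 * t mod 5 = 2 \<or> 4 * t mod 5 = 3" if "t mod 5 = 2 \<or> t mod 5 = 3" for t :: int
    using that by presburger
  ultimately show ?case using Suc by metis
qed simp

lemma card_eq_sum_of_bool: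
  fixes N :: nat
  assumes "\<And>z. z < N \<Longrightarrow> P z \<longleftrightarrow> Q z \<and> Q' z"
  shows "int (card {z. z < N \<and> P z}) = (\<Sum>z<N. of_bool (Q z) * of_bool (Q' z))"
proof -
  have "(\<Sum>z<N. of_bool (Q z) * of_bool (Q' z)) = (\<Sum>z<N. of_bool (P z) :: int)"
    using assms by (intro sum.cong refl) auto
  also have "\<dots> = int (card {z. z < N \<and> P z})"
    by (simp add: Int_def)
  finally show ?thesis by simp
qed

text \<open>Avoiding both books leaves at most \<open>m - 2\<close> common red neighbours on red
  edges and at most \<open>m\<close> common blue ones on blue edges, exactly the input of
  \<open>book_free_imp_srg\<close>; the residue of \<open>m\<close> modulo 5 then contradicts
  \<open>no_srg_mod_5\<close>.\<close>

lemma colouring_contains_book: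
  assumes m: "m = 2 ^ (2 * k + 1)"
  shows "contains_copy (colour_class (complete_graph (4 * m + 1)) c Red) (book_graph (m - 1)) \<or>
         contains_copy (colour_class (complete_graph (4 * m + 1)) c Blue) (book_graph (m + 1))"
proof (rule ccontr)
  let ?N = "4 * m + 1"
  assume *: "\<not> ?thesis"
  \<comment> \<open>The value of \<open>c\<close> on a singleton is arbitrary, hence the explicit
    \<open>x \<noteq> y\<close>.\<close>
  define R where "R x y \<longleftrightarrow> x \<noteq> y \<and> c {x, y} = Red" for x y :: nat
  have sym: "R x y \<longleftrightarrow> R y x" and irrefl: "\<not> R x x" for x y
    by (auto simp: R_def insert_commute)
  have blue_iff: "c {x, y} = Blue \<longleftrightarrow> c {x, y} \<noteq> Red" for x y
    by (cases "c {x, y}") auto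
  have red: "(\<Sum>z<?N. of_bool (R x z) * of_bool (R z y)) \<le> int m - 2"
    if "x < ?N" "y < ?N" "R x y" for x y
  proof -
    have "card {z. z < ?N \<and> z \<noteq> x \<and> z \<noteq> y \<and> c {x, z} = Red \<and> c {y, z} = Red} < m - 1"
      using * that unfolding contains_copy_book_graph_iff R_def by (meson not_less)
    moreover have "int (card {z. z < ?N \<and> z \<noteq> x \<and> z \<noteq> y \<and> c {x, z} = Red \<and> c {y, z} = Red}) =
        (\<Sum>z<?N. of_bool (R x z) * of_bool (R z y))"
      by (rule card_eq_sum_of_bool) (auto simp: R_def insert_commute)
    ultimately show ?thesis by linarith
  qed
  have blue: "(\<Sum>z<?N. of_bool (x \<noteq> z \<and> \<not> R x z) * of_bool (z \<noteq> y \<and> \<not> R z y)) \<le> int m"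
    if "x < ?N" "y < ?N" "x \<noteq> y" "\<not> R x y" for x y
  proof -
    have "card {z. z < ?N \<and> z \<noteq> x \<and> z \<noteq> y \<and> c {x, z} = Blue \<and> c {y, z} = Blue} < m + 1"
    proof -
      have "c {x, y} = Blue" using that by (simp add: R_def blue_iff)
      then show ?thesis
        using * that(1-3) unfolding contains_copy_book_graph_iff by (meson not_less)
    qed
    moreover have "int (card {z. z < ?N \<and> z \<noteq> x \<and> z \<noteq> y \<and> c {x, z} = Blue \<and> c {y, z} = Blue}) =
        (\<Sum>z<?N. of_bool (x \<noteq> z \<and> \<not> R x z) * of_bool (z \<noteq> y \<and> \<not> R z y))"
      by (rule card_eq_sum_of_bool) (auto simp: R_def insert_commute blue_iff)
    ultimately show ?thesis by linarith
  qed
  have card: "int (card {..<?N}) = 4 * int m + 1" by simp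
  have "int m mod 5 \<noteq> 2 \<and> int m mod 5 \<noteq> 3"
  proof (rule no_srg_mod_5[of "{..<?N}" "int m" R, OF _ card sym irrefl])
    show "(\<Sum>y<?N. of_bool (R x y)) = 2 * int m" if "x \<in> {..<?N}" for x
      using book_free_imp_srg(1)[of "{..<?N}" "int m" R, OF _ card sym irrefl] red blue that by auto
    show "(\<Sum>z<?N. of_bool (R x z) * of_bool (R z y)) =
        -3 * of_bool (R x y) + (int m - 1) * of_bool (x = y) + (int m + 1)"
      if "x \<in> {..<?N}" "y \<in> {..<?N}" for x y
      using book_free_imp_srg(2)[of "{..<?N}" "int m" R, OF _ card sym irrefl] red blue that by auto
  qed simp
  then show False
    using mod_5_two_power_odd[of k] by (simp add: m)
qed

theorem corollary1p2:
  fixes l n :: nat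
  assumes "l \<ge> 1"
    and "n = 2 ^ (2 * l - 1) + 1"
  shows "ramsey_number (book_graph (n - 2)) (book_graph n) = 4 * n - 3"
proof -
  obtain k where k: "l = Suc k" using assms(1) by (cases l) auto
  define m :: nat where "m = 2 ^ (2 * k + 1)"
  have n: "n = m + 1" "n - 2 = m - 1" "4 * n - 3 = 4 * m + 1"
    using assms(2) by (simp_all add: m_def k)
  \<comment> \<open>The order of the Hadamard matrix behind the lower bound.\<close>
  have "2 * m = 2 ^ (2 * l)" by (simp add: m_def k)
  then have m4: "2 * m = 4 ^ l" by (simp add: power_mult)
  have "m \<ge> 2" by (simp add: m_def)
  show ?thesis
    unfolding ramsey_number_def n(2,3) unfolding n(1)
  proof (rule Least_equality)
    show "\<forall>c. contains_copy (colour_class (complete_graph (4 * m + 1)) c Red) (book_graph (m - 1)) \<or>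
        contains_copy (colour_class (complete_graph (4 * m + 1)) c Blue) (book_graph (m + 1))"
      using colouring_contains_book[OF m_def] by blast
    fix N
    assume "\<forall>c. contains_copy (colour_class (complete_graph N) c Red) (book_graph (m - 1)) \<or>
        contains_copy (colour_class (complete_graph N) c Blue) (book_graph (m + 1))"
    then have "\<not> N \<le> 4 * m"
      using ex_colouring_without_books[OF m4 _ \<open>m \<ge> 2\<close>] by blast
    then show "4 * m + 1 \<le> N" by simp
  qed
qed

end
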